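(* Let $R$ be a commutative Noetherian ring and let $M$ be a finitely generated $R$-module such that the trace ideal $\tau_M(R)$ has positive grade. Then the map $\rho : \operatorname{End}_R(\tau_M(R)) \to \operatorname{End}_R(M^* )$, $\rho(h)(\alpha) = h\circ\alpha$, takes values in the center $Z(\operatorname{End}_R(M^* ))$, and $$\rho : \operatorname{End}_R(\tau_M(R)) \longrightarrow Z(\operatorname{End}_R(M^* ))$$ is an isomorphism of $R$-algebras.
   Context: For an $R$-module $M$ put $M^* = \operatorname{Hom}_R(M,R)$. The trace ideal of $M$ is $\tau_M(R) = \sum_{\alpha\in M^*}\alpha(M)\subseteq R$. The grade of an ideal $I$ of a Noetherian ring is the common length of the maximal $R$-regular sequences contained in $I$, equivalently $\min\{i : \operatorname{Ext}^i_R(R/I,R)\neq 0\}$ (infinite if $I=R$); $I$ has positive grade iff it contains a nonzerodivisor of $R$. $Z(S)$ denotes the center of a ring $S$. In the definition of $\rho$: each $\alpha\in M^*$ has image in $\tau_M(R)$, so for $h\in\operatorname{End}_R(\tau_M(R))$ the composite $M\xrightarrow{\alpha}\tau_M(R)\xrightarrow{h}\tau_M(R)\subseteq R$ is an element $h\circ\alpha$ of $M^*$. *)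

theory Defs
  imports "HOL-Library.Extended_Nat" "HOL-Algebra.QuotRing" "HOL-Algebra.Module"
    "HOL-Algebra.Ring_Divisibility"
begin

section \<open>Modules of homomorphisms\<close>

text \<open>Homomorphisms are extensional, i.e. \<^term>\<open>undefined\<close> outside the carrier, so that equality
  of functions is equality of homomorphisms.\<close>

definition mod_hom :: "[('a, 'r) ring_scheme, ('a, 'b, 'm) module_scheme, ('a, 'c, 'n) module_scheme]
    \<Rightarrow> ('b \<Rightarrow> 'c) set"
  where "mod_hom R M N =
    {f \<in> carrier M \<rightarrow>\<^sub>E carrier N.
      (\<forall>x\<in>carrier M. \<forall>y\<in>carrier M. f (x \<oplus>\<^bsub>M\<^esub> y) = f x \<oplus>\<^bsub>N\<^esub> f y) \<and>
      (\<forall>r\<in>carrier R. \<forall>x\<in>carrier M. f (r \<odot>\<^bsub>M\<^esub> x) = r \<odot>\<^bsub>N\<^esub> f x)}"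

text \<open>The record type \<^typ>\<open>('a, 'b) module\<close> has ring fields \<open>mult\<close> and \<open>one\<close> that the locale
  \<^locale>\<open>module\<close> ignores; they are left undefined here.\<close>

definition Hom_module :: "[('a, 'r) ring_scheme, ('a, 'b, 'm) module_scheme, ('a, 'c, 'n) module_scheme]
    \<Rightarrow> ('a, 'b \<Rightarrow> 'c) module"
  where "Hom_module R M N =
    \<lparr>carrier = mod_hom R M N, monoid.mult = undefined, one = undefined,
     zero = (\<lambda>x\<in>carrier M. \<zero>\<^bsub>N\<^esub>),
     add = (\<lambda>f g. \<lambda>x\<in>carrier M. f x \<oplus>\<^bsub>N\<^esub> g x),
     smult = (\<lambda>r f. \<lambda>x\<in>carrier M. r \<odot>\<^bsub>N\<^esub> f x)\<rparr>"

definition End_algebra :: "[('a, 'r) ring_scheme, ('a, 'b, 'm) module_scheme] \<Rightarrow> ('a, 'b \<Rightarrow> 'b) module"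
  where "End_algebra R M = (Hom_module R M M)
    \<lparr>monoid.mult := compose (carrier M), one := (\<lambda>x\<in>carrier M. x)\<rparr>"

definition regular_module :: "('a, 'r) ring_scheme \<Rightarrow> ('a, 'a) module"
  where "regular_module R =
    \<lparr>carrier = carrier R, monoid.mult = monoid.mult R, one = one R, zero = zero R, add = add R,
     smult = monoid.mult R\<rparr>"

definition ideal_module :: "[('a, 'r) ring_scheme, 'a set] \<Rightarrow> ('a, 'a) module"
  where "ideal_module R I = (regular_module R)\<lparr>carrier := I\<rparr>"

definition dual_module :: "[('a, 'r) ring_scheme, ('a, 'b, 'm) module_scheme] \<Rightarrow> ('a, 'b \<Rightarrow> 'a) module"
  where "dual_module R M = Hom_module R M (regular_module R)"

definition finitely_generated_module :: "[('a, 'r) ring_scheme, ('a, 'b, 'm) module_scheme] \<Rightarrow> bool"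
  where "finitely_generated_module R M \<longleftrightarrow>
    (\<exists>S. finite S \<and> S \<subseteq> carrier M \<and>
      carrier M = {\<Oplus>\<^bsub>M\<^esub>s\<in>S. c s \<odot>\<^bsub>M\<^esub> s | c. c \<in> S \<rightarrow> carrier R})"

text \<open>The sum of a family of ideals is the ideal generated by their union.\<close>

definition trace_ideal :: "[('a, 'r) ring_scheme, ('a, 'b, 'm) module_scheme] \<Rightarrow> 'a set"
  where "trace_ideal R M = Idl\<^bsub>R\<^esub> (\<Union>\<alpha>\<in>carrier (dual_module R M). \<alpha> ` carrier M)"


section \<open>Regular sequences and grade\<close>

text \<open>The second condition says that \<open>xs ! i\<close> is a nonzerodivisor on the quotient of \<open>R\<close> by
  the ideal generated by the preceding elements, the third that \<open>R/(xs) \<noteq> 0\<close>.\<close>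

definition regular_sequence :: "[('a, 'r) ring_scheme, 'a list] \<Rightarrow> bool"
  where "regular_sequence R xs \<longleftrightarrow>
    set xs \<subseteq> carrier R \<and>
    (\<forall>i<length xs. \<forall>a\<in>carrier R.
      xs ! i \<otimes>\<^bsub>R\<^esub> a \<in> Idl\<^bsub>R\<^esub> (set (take i xs)) \<longrightarrow> a \<in> Idl\<^bsub>R\<^esub> (set (take i xs))) \<and>
    Idl\<^bsub>R\<^esub> (set xs) \<noteq> carrier R"

definition maximal_regular_sequence_in :: "[('a, 'r) ring_scheme, 'a set, 'a list] \<Rightarrow> bool"
  where "maximal_regular_sequence_in R I xs \<longleftrightarrow>
    regular_sequence R xs \<and> set xs \<subseteq> I \<and> (\<forall>x\<in>I. \<not> regular_sequence R (xs @ [x]))"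

text \<open>For a proper ideal of a Noetherian ring, maximal regular sequences exist and all have the
  same length (Rees), so the description below is proper.\<close>

definition grade :: "[('a, 'r) ring_scheme, 'a set] \<Rightarrow> enat"
  where "grade R I =
    (if I = carrier R then \<infinity>
     else enat (THE n. length ` {xs. maximal_regular_sequence_in R I xs} = {n}))"


section \<open>Algebras\<close>

text \<open>The locale \<^locale>\<open>algebra\<close> covers commutative algebras only.\<close>

locale assoc_algebra = module R A + A?: ring A for R (structure) and A (structure) +
  assumes smult_mult_left:
      "\<lbrakk>r \<in> carrier R; a \<in> carrier A; b \<in> carrier A\<rbrakk> \<Longrightarrow>
        (r \<odot>\<^bsub>A\<^esub> a) \<otimes>\<^bsub>A\<^esub> b = r \<odot>\<^bsub>A\<^esub> (a \<otimes>\<^bsub>A\<^esub> b)"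
    and smult_mult_right:
      "\<lbrakk>r \<in> carrier R; a \<in> carrier A; b \<in> carrier A\<rbrakk> \<Longrightarrow>
        a \<otimes>\<^bsub>A\<^esub> (r \<odot>\<^bsub>A\<^esub> b) = r \<odot>\<^bsub>A\<^esub> (a \<otimes>\<^bsub>A\<^esub> b)"

definition center :: "('b, 's) ring_scheme \<Rightarrow> 'b set"
  where "center S = {z \<in> carrier S. \<forall>a\<in>carrier S. z \<otimes>\<^bsub>S\<^esub> a = a \<otimes>\<^bsub>S\<^esub> z}"

definition center_algebra :: "('a, 'b, 'm) module_scheme \<Rightarrow> ('a, 'b, 'm) module_scheme"
  where "center_algebra A = A\<lparr>carrier := center A\<rparr>"

definition algebra_iso :: "[('a, 'r) ring_scheme, ('a, 'b, 'm) module_scheme, ('a, 'c, 'n) module_scheme]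
    \<Rightarrow> ('b \<Rightarrow> 'c) set"
  where "algebra_iso R A B =
    {f \<in> ring_iso A B. \<forall>r\<in>carrier R. \<forall>a\<in>carrier A. f (r \<odot>\<^bsub>A\<^esub> a) = r \<odot>\<^bsub>B\<^esub> f a}"

definition rho :: "[('a, 'r) ring_scheme, ('a, 'b, 'm) module_scheme]
    \<Rightarrow> ('a \<Rightarrow> 'a) \<Rightarrow> ('b \<Rightarrow> 'a) \<Rightarrow> ('b \<Rightarrow> 'a)"
  where "rho R M h = (\<lambda>\<alpha>\<in>carrier (dual_module R M). compose (carrier M) h \<alpha>)"


section \<open>Well-definedness\<close>

lemma mod_homI:
  assumes "f \<in> extensional (carrier M)"
    and "\<And>x. x \<in> carrier M \<Longrightarrow> f x \<in> carrier N"
    and "\<And>x y. x \<in> carrier M \<Longrightarrow> y \<in> carrier M \<Longrightarrow> f (x \<oplus>\<^bsub>M\<^esub> y) = f x \<oplus>\<^bsub>N\<^esub> f y"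
    and "\<And>r x. r \<in> carrier R \<Longrightarrow> x \<in> carrier M \<Longrightarrow> f (r \<odot>\<^bsub>M\<^esub> x) = r \<odot>\<^bsub>N\<^esub> f x"
  shows "f \<in> mod_hom R M N"
  using assms by (auto simp: mod_hom_def PiE_iff)

lemma mod_homD:
  assumes "f \<in> mod_hom R M N"
  shows "f \<in> extensional (carrier M)"
    and "\<And>x. x \<in> carrier M \<Longrightarrow> f x \<in> carrier N"
    and "\<And>x y. x \<in> carrier M \<Longrightarrow> y \<in> carrier M \<Longrightarrow> f (x \<oplus>\<^bsub>M\<^esub> y) = f x \<oplus>\<^bsub>N\<^esub> f y"
    and "\<And>r x. r \<in> carrier R \<Longrightarrow> x \<in> carrier M \<Longrightarrow> f (r \<odot>\<^bsub>M\<^esub> x) = r \<odot>\<^bsub>N\<^esub> f x"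
  using assms by (auto simp: mod_hom_def PiE_iff)

lemma (in module) module_Hom_module:
  assumes "module R N"
  shows "module R (Hom_module R M N)"
proof -
  interpret N: module R N by fact
  note [simp] = mod_homD[where R = R and M = M and N = N] Hom_module_def
    N.smult_r_distr N.smult_l_distr N.smult_assoc1
  have comm: "r \<odot>\<^bsub>N\<^esub> (s \<odot>\<^bsub>N\<^esub> x) = s \<odot>\<^bsub>N\<^esub> (r \<odot>\<^bsub>N\<^esub> x)"
    if "r \<in> carrier R" "s \<in> carrier R" "x \<in> carrier N" for r s x
    using that by (metis N.smult_assoc1 R.m_comm)
  have "abelian_group (Hom_module R M N)"
  proof (rule abelian_groupI)
    fix f assume "f \<in> carrier (Hom_module R M N)"
    then have f: "f \<in> mod_hom R M N" by simp
    have "(\<lambda>x\<in>carrier M. \<ominus>\<^bsub>N\<^esub> f x) \<in> mod_hom R M N"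
      by (rule mod_homI) (simp_all add: f N.minus_add N.smult_r_minus)
    moreover have "(\<lambda>x\<in>carrier M. \<ominus>\<^bsub>N\<^esub> f x) \<oplus>\<^bsub>Hom_module R M N\<^esub> f = \<zero>\<^bsub>Hom_module R M N\<^esub>"
      by (simp add: f N.l_neg cong: restrict_cong)
    ultimately show "\<exists>g\<in>carrier (Hom_module R M N). g \<oplus>\<^bsub>Hom_module R M N\<^esub> f = \<zero>\<^bsub>Hom_module R M N\<^esub>"
      by (intro bexI) simp_all
  qed (auto intro!: mod_homI restrict_ext extensionalityI[where A = "carrier M"] simp: N.a_ac)
  then show ?thesis
    by (intro moduleI R.is_cring)
      (auto intro!: mod_homI restrict_ext extensionalityI[where A = "carrier M"] simp: N.a_ac comm)
qed

lemma (in module) assoc_algebra_End_algebra: "assoc_algebra R (End_algebra R M)"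
proof -
  interpret H: module R "Hom_module R M M" by (rule module_Hom_module) (rule module_axioms)
  have eqs: "carrier (End_algebra R M) = carrier (Hom_module R M M)"
    "add (End_algebra R M) = add (Hom_module R M M)"
    "ring.zero (End_algebra R M) = ring.zero (Hom_module R M M)"
    "smult (End_algebra R M) = smult (Hom_module R M M)"
    by (simp_all add: End_algebra_def)
  have ag: "abelian_group (End_algebra R M)"
  proof (rule abelian_groupI, unfold eqs)
    fix x assume "x \<in> carrier (Hom_module R M M)"
    then show "\<exists>y\<in>carrier (Hom_module R M M). y \<oplus>\<^bsub>Hom_module R M M\<^esub> x = \<zero>\<^bsub>Hom_module R M M\<^esub>"
      using H.l_neg H.a_inv_closed by blast
  qed (use H.a_ac in auto)
  have mod: "module R (End_algebra R M)"
    by (intro moduleI R.is_cring ag; unfold eqs)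
      (simp_all add: H.smult_l_distr H.smult_r_distr H.smult_assoc1)
  note [simp] = mod_homD[where R = R and M = M and N = M] Hom_module_def End_algebra_def compose_eq
  have "monoid (End_algebra R M)"
    by (rule monoidI)
      (auto intro!: mod_homI extensionalityI[where A = "carrier M"])
  then have "ring (End_algebra R M)"
    by (intro ringI ag)
      (auto intro!: mod_homI extensionalityI[where A = "carrier M"])
  moreover have "assoc_algebra_axioms R (End_algebra R M)"
    by unfold_locales
      (auto intro!: mod_homI extensionalityI[where A = "carrier M"])
  ultimately show ?thesis
    using mod by (simp add: assoc_algebra_def)
qed

lemma (in cring) module_regular_module: "module R (regular_module R)"
  by (intro moduleI abelian_groupI is_cring)
    (auto simp: regular_module_def a_ac m_ac l_distr r_distr intro: l_neg a_inv_closed)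

lemma (in cring) module_ideal_module:
  assumes "ideal I R" shows "module R (ideal_module R I)"
proof -
  interpret I: ideal I R by fact
  interpret L: module R "regular_module R" by (rule module_regular_module)
  have "submodule I R (regular_module R)"
  proof (rule L.submoduleI)
    fix a assume a: "a \<in> I"
    then have "\<ominus>\<^bsub>regular_module R\<^esub> a = (\<ominus> \<one>) \<odot>\<^bsub>regular_module R\<^esub> a"
      using L.smult_l_minus[of \<one> a] by (simp add: regular_module_def I.Icarr)
    with a show "\<ominus>\<^bsub>regular_module R\<^esub> a \<in> I"
      by (simp add: regular_module_def I.I_l_closed)
  qed (use I.a_subset in \<open>auto simp: regular_module_def I.I_l_closed\<close>)
  then have "module R ((regular_module R)\<lparr>carrier := I\<rparr>)"
    using L.module_axioms by (rule submodule.submodule_is_module)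
  then show ?thesis by (simp add: ideal_module_def)
qed

lemma (in module) ideal_trace_ideal: "ideal (trace_ideal R M) R"
  unfolding trace_ideal_def
  by (rule R.genideal_ideal)
    (auto simp: dual_module_def Hom_module_def mod_hom_def regular_module_def PiE_iff)

lemma (in assoc_algebra) assoc_algebra_center_algebra: "assoc_algebra R (center_algebra A)"
proof -
  have C: "z \<in> carrier A" if "z \<in> center A" for z
    using that by (simp add: center_def)
  have mult: "x \<otimes>\<^bsub>A\<^esub> y \<in> center A" if "x \<in> center A" "y \<in> center A" for x y
  proof -
    have "(x \<otimes>\<^bsub>A\<^esub> y) \<otimes>\<^bsub>A\<^esub> a = a \<otimes>\<^bsub>A\<^esub> (x \<otimes>\<^bsub>A\<^esub> y)" if a: "a \<in> carrier A" for a
    proof -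
      have "x \<otimes>\<^bsub>A\<^esub> a = a \<otimes>\<^bsub>A\<^esub> x" "y \<otimes>\<^bsub>A\<^esub> a = a \<otimes>\<^bsub>A\<^esub> y"
        using \<open>x \<in> center A\<close> \<open>y \<in> center A\<close> a unfolding center_def by blast+
      then show ?thesis
        using C[OF \<open>x \<in> center A\<close>] C[OF \<open>y \<in> center A\<close>] a by (metis A.m_assoc)
    qed
    with C[OF that(1)] C[OF that(2)] show ?thesis
      by (auto simp: center_def)
  qed
  have sub: "submodule (center A) R A"
    by (rule submoduleI)
      (auto simp: center_def A.l_distr A.r_distr A.l_minus A.r_minus smult_mult_left smult_mult_right)
  have mod: "module R (center_algebra A)"
    unfolding center_algebra_def using sub module_axioms by (rule submodule.submodule_is_module)
  interpret CA: module R "center_algebra A" by (rule mod)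
  have one: "\<one>\<^bsub>A\<^esub> \<in> center A"
    by (simp add: center_def)
  have "monoid (center_algebra A)"
    by (rule monoidI) (auto simp: center_algebra_def mult one C A.m_assoc)
  then have "ring (center_algebra A)"
    by (intro ringI CA.abelian_group_axioms) (auto simp: center_algebra_def C A.l_distr A.r_distr)
  moreover have "assoc_algebra_axioms R (center_algebra A)"
    by unfold_locales (auto simp: center_algebra_def C smult_mult_left smult_mult_right)
  ultimately show ?thesis
    using mod by (simp add: assoc_algebra_def)
qed

end

theory Submission
  imports Defs
begin

text \<open>Let \<open>I\<close> be the trace ideal and \<open>x \<in> I\<close> a nonzerodivisor. For \<open>h \<in> End(I)\<close> we have
  \<open>x (h \<circ> \<alpha>) = h(x) \<alpha>\<close>, so every endomorphism of \<open>M\<^sup>*\<close> commutes with \<open>\<rho>(h)\<close> after multiplication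
  by \<open>x\<close>, hence commutes with it. As the values \<open>\<alpha>(m)\<close> generate \<open>I\<close>, \<open>\<rho>\<close> is injective.
  Conversely, a central \<open>f\<close> commutes with the endomorphisms \<open>\<beta> \<mapsto> \<beta>(m) \<alpha>\<close>, that is,
  \<open>\<beta>(m) f(\<alpha>)(n) = f(\<beta>)(m) \<alpha>(n)\<close>. Therefore the equations \<open>\<beta>(m) h(y) = f(\<beta>)(m) y\<close> for all \<open>\<beta>\<close> and
  \<open>m\<close> have a solution \<open>h(y) \<in> I\<close> for every \<open>y \<in> I\<close>, which is unique because \<open>I\<close> has trivial annihilator,
  and \<open>\<rho>(h) = f\<close>.\<close>

text \<open>If every element of \<open>I\<close> is a zero divisor, no list starting in
  \<open>I\<close> is regular. Then \<open>[]\<close> is the only maximal regular sequence in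
  \<open>I\<close>, and the \<open>THE\<close> in \<open>grade\<close> evaluates to 0.\<close>

lemma (in cring) nonzerodivisor_if_grade_pos:
  assumes "ideal I R" and "grade R I > 0"
  shows "\<exists>x\<in>I. \<forall>a\<in>carrier R. x \<otimes> a = \<zero> \<longrightarrow> a = \<zero>"
proof (rule ccontr)
  assume no: "\<not> ?thesis"
  interpret I: ideal I R by fact
  \<comment> \<open>The unit is a nonzerodivisor, so it lies outside \<open>I\<close>; this excludes
    the infinite case of \<open>grade\<close>.\<close>
  have "I \<noteq> carrier R"
    using no by (metis l_one one_closed)
  have Idl0: "Idl\<^bsub>R\<^esub> {} = {\<zero>}"
  proof
    show "Idl {} \<subseteq> {\<zero>}"
      by (rule genideal_minimal[OF zeroideal]) simp
    show "{\<zero>} \<subseteq> Idl {}"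
      using genideal_ideal[of "{}"] by (simp add: additive_subgroup.zero_closed ideal.axioms(1))
  qed
  \<comment> \<open>Regularity of \<open>[]\<close> means that its ideal \<open>{\<zero>}\<close> is
    proper.\<close>
  have "carrier R \<noteq> {\<zero>}"
    using \<open>I \<noteq> carrier R\<close> I.a_subset I.zero_closed by (metis empty_iff subset_singletonD)
  have notreg: "\<not> regular_sequence R (x # xs)" if "x \<in> I" for x xs
  proof
    assume "regular_sequence R (x # xs)"
    \<comment> \<open>This is the case \<open>i = 0\<close> of the second condition, with no
      preceding elements.\<close>
    then have "\<forall>a\<in>carrier R. x \<otimes> a \<in> {\<zero>} \<longrightarrow> a \<in> {\<zero>}"
      unfolding regular_sequence_def by (force simp: Idl0)
    with no that show False by auto
  qed
  have "{xs. maximal_regular_sequence_in R I xs} = {[]}"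
  proof (intro equalityI subsetI)
    fix xs assume "xs \<in> {xs. maximal_regular_sequence_in R I xs}"
    then show "xs \<in> {[]}"
      using notreg by (cases xs) (auto simp: maximal_regular_sequence_in_def)
  next
    fix xs :: "'a list" assume "xs \<in> {[]}"
    moreover have "regular_sequence R []"
      using \<open>carrier R \<noteq> {\<zero>}\<close> by (simp add: regular_sequence_def Idl0)
    ultimately show "xs \<in> {xs. maximal_regular_sequence_in R I xs}"
      using notreg by (simp add: maximal_regular_sequence_in_def)
  qed
  then have "grade R I = 0"
    using \<open>I \<noteq> carrier R\<close> by (simp add: grade_def zero_enat_def)
  with assms(2) show False by simp
qed

section \<open>Elementwise descriptions of the dual and of the endomorphism sets\<close>

context module
begin

abbreviation "Dual \<equiv> mod_hom R M (regular_module R)"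
abbreviation "Trace \<equiv> trace_ideal R M"
abbreviation "EndTrace \<equiv> mod_hom R (ideal_module R Trace) (ideal_module R Trace)"
abbreviation "EndDual \<equiv> mod_hom R (dual_module R M) (dual_module R M)"

lemma dual_module_simps:
  "carrier (dual_module R M) = Dual"
  "add (dual_module R M) = (\<lambda>\<alpha> \<beta>. \<lambda>m\<in>carrier M. \<alpha> m \<oplus> \<beta> m)"
  "smult (dual_module R M) = (\<lambda>r \<alpha>. \<lambda>m\<in>carrier M. r \<otimes> \<alpha> m)"
  by (simp_all add: dual_module_def Hom_module_def regular_module_def)

lemma ideal_module_simps:
  "carrier (ideal_module R I) = I"
  "add (ideal_module R I) = add R"
  "smult (ideal_module R I) = monoid.mult R"
  by (simp_all add: ideal_module_def regular_module_def)

lemma End_algebra_simps: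
  "carrier (End_algebra R N) = mod_hom R N N"
  "monoid.mult (End_algebra R N) = compose (carrier N)"
  "one (End_algebra R N) = (\<lambda>x\<in>carrier N. x)"
  "add (End_algebra R N) = (\<lambda>f g. \<lambda>x\<in>carrier N. f x \<oplus>\<^bsub>N\<^esub> g x)"
  "smult (End_algebra R N) = (\<lambda>r f. \<lambda>x\<in>carrier N. r \<odot>\<^bsub>N\<^esub> f x)"
  by (simp_all add: End_algebra_def Hom_module_def)

lemma Dual_iff:
  "\<alpha> \<in> Dual \<longleftrightarrow> \<alpha> \<in> carrier M \<rightarrow>\<^sub>E carrier R \<and>
    (\<forall>m\<in>carrier M. \<forall>n\<in>carrier M. \<alpha> (m \<oplus>\<^bsub>M\<^esub> n) = \<alpha> m \<oplus> \<alpha> n) \<and>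
    (\<forall>r\<in>carrier R. \<forall>m\<in>carrier M. \<alpha> (r \<odot>\<^bsub>M\<^esub> m) = r \<otimes> \<alpha> m)"
  by (simp add: mod_hom_def regular_module_def)

lemma Dual_apply [simp]:
  assumes "\<alpha> \<in> Dual"
  shows "m \<in> carrier M \<Longrightarrow> \<alpha> m \<in> carrier R"
    and "m \<in> carrier M \<Longrightarrow> n \<in> carrier M \<Longrightarrow> \<alpha> (m \<oplus>\<^bsub>M\<^esub> n) = \<alpha> m \<oplus> \<alpha> n"
    and "r \<in> carrier R \<Longrightarrow> m \<in> carrier M \<Longrightarrow> \<alpha> (r \<odot>\<^bsub>M\<^esub> m) = r \<otimes> \<alpha> m"
  using mod_homD[OF assms] by (simp_all add: regular_module_def)

lemma Dual_ext:
  assumes "\<alpha> \<in> Dual" "\<beta> \<in> Dual" "\<And>m. m \<in> carrier M \<Longrightarrow> \<alpha> m = \<beta> m"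
  shows "\<alpha> = \<beta>"
  using assms unfolding Dual_iff by (blast intro: PiE_ext)

lemma EndTrace_iff:
  "h \<in> EndTrace \<longleftrightarrow> h \<in> Trace \<rightarrow>\<^sub>E Trace \<and>
    (\<forall>y\<in>Trace. \<forall>z\<in>Trace. h (y \<oplus> z) = h y \<oplus> h z) \<and>
    (\<forall>r\<in>carrier R. \<forall>y\<in>Trace. h (r \<otimes> y) = r \<otimes> h y)"
  by (simp add: mod_hom_def ideal_module_simps)

lemma EndDual_iff:
  "f \<in> EndDual \<longleftrightarrow> f \<in> Dual \<rightarrow>\<^sub>E Dual \<and>
    (\<forall>\<alpha>\<in>Dual. \<forall>\<beta>\<in>Dual. f (\<lambda>m\<in>carrier M. \<alpha> m \<oplus> \<beta> m) = (\<lambda>m\<in>carrier M. f \<alpha> m \<oplus> f \<beta> m)) \<and>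
    (\<forall>r\<in>carrier R. \<forall>\<alpha>\<in>Dual. f (\<lambda>m\<in>carrier M. r \<otimes> \<alpha> m) = (\<lambda>m\<in>carrier M. r \<otimes> f \<alpha> m))"
  \<comment> \<open>The instance unfolds only the outer \<open>mod_hom\<close>, so that
    \<open>Dual\<close> stays folded.\<close>
  by (simp add: mod_hom_def[of _ "dual_module R M"] dual_module_simps)

lemma EndTrace_apply [simp]:
  assumes "h \<in> EndTrace"
  shows "y \<in> Trace \<Longrightarrow> h y \<in> Trace"
    and "y \<in> Trace \<Longrightarrow> z \<in> Trace \<Longrightarrow> h (y \<oplus> z) = h y \<oplus> h z"
    and "r \<in> carrier R \<Longrightarrow> y \<in> Trace \<Longrightarrow> h (r \<otimes> y) = r \<otimes> h y"
  using mod_homD[OF assms] by (simp_all add: ideal_module_simps)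

lemma EndDual_apply [simp]:
  assumes "f \<in> EndDual"
  shows "\<alpha> \<in> Dual \<Longrightarrow> f \<alpha> \<in> Dual"
    and "\<alpha> \<in> Dual \<Longrightarrow> \<beta> \<in> Dual \<Longrightarrow>
      f (\<lambda>m\<in>carrier M. \<alpha> m \<oplus> \<beta> m) = (\<lambda>m\<in>carrier M. f \<alpha> m \<oplus> f \<beta> m)"
    and "r \<in> carrier R \<Longrightarrow> \<alpha> \<in> Dual \<Longrightarrow>
      f (\<lambda>m\<in>carrier M. r \<otimes> \<alpha> m) = (\<lambda>m\<in>carrier M. r \<otimes> f \<alpha> m)"
  using mod_homD[OF assms] by (simp_all add: dual_module_simps)

lemma Dual_add [simp]: "\<alpha> \<in> Dual \<Longrightarrow> \<beta> \<in> Dual \<Longrightarrow> (\<lambda>m\<in>carrier M. \<alpha> m \<oplus> \<beta> m) \<in> Dual"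
  by (subst Dual_iff) (simp add: R.a_ac R.r_distr)

lemma Dual_smult [simp]: "r \<in> carrier R \<Longrightarrow> \<alpha> \<in> Dual \<Longrightarrow> (\<lambda>m\<in>carrier M. r \<otimes> \<alpha> m) \<in> Dual"
  by (subst Dual_iff) (simp add: R.m_ac R.r_distr)

section \<open>Elements of the trace ideal\<close>

lemma Trace_carrier [simp]: "y \<in> Trace \<Longrightarrow> y \<in> carrier R"
  using ideal.Icarr[OF ideal_trace_ideal] .

lemma Trace_add [simp]: "y \<in> Trace \<Longrightarrow> z \<in> Trace \<Longrightarrow> y \<oplus> z \<in> Trace"
  using ideal_trace_ideal by (simp add: additive_subgroup.a_closed ideal.axioms(1))

lemma Trace_smult [simp]: "r \<in> carrier R \<Longrightarrow> y \<in> Trace \<Longrightarrow> r \<otimes> y \<in> Trace"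
  using ideal.I_l_closed[OF ideal_trace_ideal] .

lemma Trace_generators_subset: "(\<Union>\<alpha>\<in>Dual. \<alpha> ` carrier M) \<subseteq> carrier R"
  by auto

lemma Dual_in_Trace [simp]: "\<alpha> \<in> Dual \<Longrightarrow> m \<in> carrier M \<Longrightarrow> \<alpha> m \<in> Trace"
  using R.genideal_self[OF Trace_generators_subset]
  by (auto simp: trace_ideal_def dual_module_simps)

text \<open>The ring elements satisfying \<open>P\<close> form an ideal that contains the
  generators. Negatives need no case of their own, being multiples by
  \<open>\<ominus> \<one>\<close>.\<close>

lemma Trace_induct [consumes 1, case_names gen zero add smult]:
  assumes "y \<in> Trace"
    and gen: "\<And>\<alpha> m. \<alpha> \<in> Dual \<Longrightarrow> m \<in> carrier M \<Longrightarrow> P (\<alpha> m)"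
    and zero: "P \<zero>"
    and add: "\<And>y z. y \<in> carrier R \<Longrightarrow> z \<in> carrier R \<Longrightarrow> P y \<Longrightarrow> P z \<Longrightarrow> P (y \<oplus> z)"
    and smult: "\<And>r y. r \<in> carrier R \<Longrightarrow> y \<in> carrier R \<Longrightarrow> P y \<Longrightarrow> P (r \<otimes> y)"
  shows "P y"
proof -
  have "P (\<ominus> a)" if "a \<in> carrier R" "P a" for a
    using smult[of "\<ominus> \<one>" a] that by (simp add: R.l_minus)
  then have "subgroup {a \<in> carrier R. P a} (add_monoid R)"
    by unfold_locales (auto simp: zero add simp flip: a_inv_def)
  then have "ideal {a \<in> carrier R. P a} R"
    using smult by (intro idealI R.ring_axioms) (simp_all, metis R.m_comm)
  then have "Trace \<subseteq> {a \<in> carrier R. P a}"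
    unfolding trace_ideal_def by (rule R.genideal_minimal) (auto simp: dual_module_simps gen)
  with assms(1) show ?thesis by auto
qed

text \<open>This is the injectivity of \<open>rho\<close>: linear maps that agree on generators
  agree.\<close>

lemma EndTrace_ext:
  assumes h: "h \<in> EndTrace" "h' \<in> EndTrace"
    and eq: "\<And>\<alpha> m. \<alpha> \<in> Dual \<Longrightarrow> m \<in> carrier M \<Longrightarrow> h (\<alpha> m) = h' (\<alpha> m)"
  shows "h = h'"
proof (rule PiE_ext)
  show "h \<in> Trace \<rightarrow>\<^sub>E Trace" "h' \<in> Trace \<rightarrow>\<^sub>E Trace"
    using h by (simp_all add: EndTrace_iff)
  have zero: "\<zero> \<in> Trace"
    using ideal_trace_ideal by (simp add: additive_subgroup.zero_closed ideal.axioms(1))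
  have "g \<zero> = \<zero>" if "g \<in> EndTrace" for g
    using that zero unfolding EndTrace_iff
    by (metis R.l_null R.zero_closed Trace_carrier PiE_mem)
  then have zeros: "h \<zero> = \<zero>" "h' \<zero> = \<zero>"
    using h by blast+
  \<comment> \<open>Membership is carried along because the induction cases provide only elements of
    \<open>R\<close>, while \<open>h\<close> and \<open>h'\<close> are linear on
    \<open>Trace\<close>.\<close>
  have "y \<in> Trace \<and> h y = h' y" if "y \<in> Trace" for y
    using that by (induction rule: Trace_induct) (simp_all add: eq zero zeros h)
  then show "h y = h' y" if "y \<in> Trace" for y
    using that by blast
qed

section \<open>The map \<open>rho\<close>\<close>

lemma compose_in_Dual:
  "h \<in> EndTrace \<Longrightarrow> \<alpha> \<in> Dual \<Longrightarrow> compose (carrier M) h \<alpha> \<in> Dual"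
  by (subst Dual_iff) (simp add: compose_def)

lemma rho_eq: "\<alpha> \<in> Dual \<Longrightarrow> rho R M h \<alpha> = compose (carrier M) h \<alpha>"
  by (simp add: rho_def dual_module_simps)

lemma rho_apply: "\<alpha> \<in> Dual \<Longrightarrow> m \<in> carrier M \<Longrightarrow> rho R M h \<alpha> m = h (\<alpha> m)"
  by (simp add: rho_eq compose_eq)

lemma rho_in_EndDual:
  assumes "h \<in> EndTrace" shows "rho R M h \<in> EndDual"
  unfolding EndDual_iff
proof (intro conjI ballI)
  show "rho R M h \<in> Dual \<rightarrow>\<^sub>E Dual"
    using assms by (auto simp: rho_def dual_module_simps compose_in_Dual)
qed (use assms in \<open>simp_all add: rho_eq compose_def cong: restrict_cong\<close>)

lemma EndDual_ext:
  assumes "f \<in> EndDual" "g \<in> EndDual"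
    and "\<And>\<alpha> m. \<alpha> \<in> Dual \<Longrightarrow> m \<in> carrier M \<Longrightarrow> f \<alpha> m = g \<alpha> m"
  shows "f = g"
proof (rule PiE_ext)
  show "f \<in> Dual \<rightarrow>\<^sub>E Dual" "g \<in> Dual \<rightarrow>\<^sub>E Dual"
    using assms(1,2) unfolding EndDual_iff by blast+
  show "f \<alpha> = g \<alpha>" if "\<alpha> \<in> Dual" for \<alpha>
    using that assms by (intro Dual_ext) simp_all
qed

section \<open>Central endomorphisms of the dual\<close>

lemma center_EndDual_iff:
  "f \<in> center (End_algebra R (dual_module R M)) \<longleftrightarrow>
    f \<in> EndDual \<and> (\<forall>g\<in>EndDual. \<forall>\<alpha>\<in>Dual. f (g \<alpha>) = g (f \<alpha>))"
proof -
  have "compose Dual f g = compose Dual g f \<longleftrightarrow> (\<forall>\<alpha>\<in>Dual. f (g \<alpha>) = g (f \<alpha>))" for g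
    by (simp add: compose_def fun_eq_iff Ball_def restrict_def)
  then show ?thesis
    by (auto simp: center_def End_algebra_simps dual_module_simps)
qed

text \<open>Evaluate \<open>f (g \<beta>) = g (f \<beta>)\<close> at \<open>n\<close> for the
  endomorphism \<open>g\<close> that sends \<gamma> to the multiple of \<alpha> by
  \<open>\<gamma> m\<close>; linearity of \<open>f\<close> extracts the scalar
  \<open>\<beta> m\<close>.\<close>

lemma central_exchange:
  assumes "f \<in> center (End_algebra R (dual_module R M))"
    and \<alpha>: "\<alpha> \<in> Dual" and \<beta>: "\<beta> \<in> Dual" and m: "m \<in> carrier M" and n: "n \<in> carrier M"
  shows "\<beta> m \<otimes> f \<alpha> n = f \<beta> m \<otimes> \<alpha> n"
proof -
  have f: "f \<in> EndDual" and fc: "\<And>g \<gamma>. g \<in> EndDual \<Longrightarrow> \<gamma> \<in> Dual \<Longrightarrow> f (g \<gamma>) = g (f \<gamma>)"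
    using assms(1) by (auto simp: center_EndDual_iff)
  define g where "g = (\<lambda>\<gamma>\<in>Dual. \<lambda>k\<in>carrier M. \<gamma> m \<otimes> \<alpha> k)"
  have "g \<in> EndDual"
    using \<alpha> m by (simp add: EndDual_iff g_def R.l_distr R.m_assoc cong: restrict_cong)
  then have "f (g \<beta>) = g (f \<beta>)"
    using fc \<beta> by blast
  moreover have "f (g \<beta>) = (\<lambda>k\<in>carrier M. \<beta> m \<otimes> f \<alpha> k)"
    by (simp only: g_def restrict_apply' EndDual_apply[OF f] Dual_apply \<alpha> \<beta> m)
  moreover have "g (f \<beta>) = (\<lambda>k\<in>carrier M. f \<beta> m \<otimes> \<alpha> k)"
    using f \<beta> by (simp add: g_def)
  ultimately have "(\<lambda>k\<in>carrier M. \<beta> m \<otimes> f \<alpha> k) n = (\<lambda>k\<in>carrier M. f \<beta> m \<otimes> \<alpha> k) n"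
    by simp
  with n show ?thesis
    by simp
qed

end

section \<open>Trace ideals containing a nonzerodivisor\<close>

locale regular_trace = module +
  fixes x
  assumes x_Trace [simp]: "x \<in> Trace"
    and x_regular: "a \<in> carrier R \<Longrightarrow> x \<otimes> a = \<zero> \<Longrightarrow> a = \<zero>"
begin

lemma x_cancel:
  assumes "x \<otimes> a = x \<otimes> b" "a \<in> carrier R" "b \<in> carrier R" shows "a = b"
proof -
  have "x \<otimes> (a \<ominus> b) = \<zero>"
    using assms by (simp add: R.r_minus R.r_distr a_minus_def R.r_neg)
  then have "a \<ominus> b = \<zero>"
    using assms by (simp add: x_regular)
  then show ?thesis
    using assms by simp
qed

text \<open>The equations extend from generators to every element of \<open>Trace\<close>, in
  particular to \<open>x\<close>, which cancels.\<close>

lemma Trace_faithful: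
  assumes "a \<in> carrier R" "b \<in> carrier R"
    and "\<And>\<beta> m. \<beta> \<in> Dual \<Longrightarrow> m \<in> carrier M \<Longrightarrow> \<beta> m \<otimes> a = \<beta> m \<otimes> b"
  shows "a = b"
proof -
  have "y \<otimes> a = y \<otimes> b" if "y \<in> Trace" for y
    using that by (induction rule: Trace_induct) (simp_all add: assms R.l_distr R.m_assoc)
  then show ?thesis
    using assms x_cancel x_Trace by blast
qed

lemma rho_central:
  assumes h: "h \<in> EndTrace"
  shows "rho R M h \<in> center (End_algebra R (dual_module R M))"
  unfolding center_EndDual_iff
proof (intro conjI ballI rho_in_EndDual h)
  fix f \<alpha> assume f: "f \<in> EndDual" and \<alpha>: "\<alpha> \<in> Dual"
  \<comment> \<open>Both sides equal \<open>h (x \<otimes> y)\<close>, with \<open>x\<close> or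
    \<open>y\<close> taken as the scalar.\<close>
  have comm: "x \<otimes> h y = h x \<otimes> y" if "y \<in> Trace" for y
    using h that by (metis EndTrace_apply(1,3) R.m_comm Trace_carrier x_Trace)
  have "(\<lambda>m\<in>carrier M. x \<otimes> rho R M h \<alpha> m) = (\<lambda>m\<in>carrier M. h x \<otimes> \<alpha> m)"
    using \<alpha> by (simp add: rho_apply comm cong: restrict_cong)
  then have "f (\<lambda>m\<in>carrier M. x \<otimes> rho R M h \<alpha> m) = f (\<lambda>m\<in>carrier M. h x \<otimes> \<alpha> m)"
    by simp
  \<comment> \<open>Linearity of \<open>f\<close> moves the scalars \<open>x\<close> and
    \<open>h x\<close> outside.\<close>
  then have eq: "(\<lambda>m\<in>carrier M. x \<otimes> f (rho R M h \<alpha>) m) = (\<lambda>m\<in>carrier M. h x \<otimes> f \<alpha> m)"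
    by (simp only: EndDual_apply[OF f] \<alpha> EndDual_apply(1)[OF rho_in_EndDual[OF h]]
        EndTrace_apply(1)[OF h] Trace_carrier x_Trace)
  have "x \<otimes> f (rho R M h \<alpha>) m = h x \<otimes> f \<alpha> m" if "m \<in> carrier M" for m
    using fun_cong[OF eq, of m] that by simp
  then show "rho R M h (f \<alpha>) = f (rho R M h \<alpha>)"
    using f \<alpha> h rho_in_EndDual[OF h]
    by (intro Dual_ext x_cancel[of "rho R M h (f \<alpha>) _"]) (simp_all add: rho_apply comm)
qed

lemma rho_surj:
  assumes fc: "f \<in> center (End_algebra R (dual_module R M))"
  shows "\<exists>h\<in>EndTrace. rho R M h = f"
proof -
  have f: "f \<in> EndDual"
    using fc by (simp add: center_EndDual_iff)
  \<comment> \<open>\<open>Q y z\<close> makes \<open>z\<close> the only candidate for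
    \<open>h y\<close>: if \<open>rho R M h = f\<close>, then \<open>\<beta> m \<otimes> h y = h
    (\<beta> m) \<otimes> y = f \<beta> m \<otimes> y\<close>.\<close>
  define Q where "Q y z \<longleftrightarrow> z \<in> Trace \<and>
    (\<forall>\<beta>\<in>Dual. \<forall>m\<in>carrier M. \<beta> m \<otimes> z = f \<beta> m \<otimes> y)" for y z
  have QI: "Q y z"
    if "z \<in> Trace" "\<And>\<beta> m. \<beta> \<in> Dual \<Longrightarrow> m \<in> carrier M \<Longrightarrow> \<beta> m \<otimes> z = f \<beta> m \<otimes> y" for y z
    using that unfolding Q_def by blast
  have Q_Trace: "z \<in> Trace" if "Q y z" for y z
    using that unfolding Q_def by blast
  have Q_eq: "\<beta> m \<otimes> z = f \<beta> m \<otimes> y" if "Q y z" "\<beta> \<in> Dual" "m \<in> carrier M" for y z \<beta> m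
    using that unfolding Q_def by blast
  have Q_unique: "z = z'" if Q: "Q y z" "Q y z'" for y z z'
  proof (rule Trace_faithful)
    show "\<beta> m \<otimes> z = \<beta> m \<otimes> z'" if "\<beta> \<in> Dual" "m \<in> carrier M" for \<beta> m
      using Q_eq[OF Q(1) that] Q_eq[OF Q(2) that] by (rule trans[OF _ sym])
  qed (rule Trace_carrier, rule Q_Trace, rule Q)+
  \<comment> \<open>Centrality of \<open>f\<close> enters here: on generators the equations are
    \<open>central_exchange\<close>.\<close>
  have Q_gen: "Q (\<alpha> n) (f \<alpha> n)" if \<alpha>: "\<alpha> \<in> Dual" and n: "n \<in> carrier M" for \<alpha> n
    by (rule QI[OF Dual_in_Trace[OF EndDual_apply(1)[OF f \<alpha>] n]])
      (rule central_exchange[OF fc \<alpha> _ _ n])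
  have Q_add: "Q (y \<oplus> y') (z \<oplus> z')" if Q: "Q y z" "Q y' z'" and "y \<in> carrier R" "y' \<in> carrier R"
    for y y' z z'
    by (rule QI)
      (simp_all add: that f Q[THEN Q_Trace] Q[THEN Q_eq] R.r_distr)
  have Q_smult: "Q (r \<otimes> y) (r \<otimes> z)" if Q: "Q y z" and "y \<in> carrier R" "r \<in> carrier R" for r y z
    by (rule QI)
      (simp_all add: that f Q[THEN Q_Trace] Q[THEN Q_eq] R.m_lcomm)
  have Q_zero: "Q \<zero> \<zero>"
    by (rule QI) (simp_all add: f ideal_trace_ideal additive_subgroup.zero_closed ideal.axioms(1))
  have Q_ex: "\<exists>z. Q y z" if "y \<in> Trace" for y
    using that by (induction rule: Trace_induct) (use Q_gen Q_add Q_smult Q_zero in blast)+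
  \<comment> \<open>By uniqueness the value does not depend on how \<open>y\<close> is written in
    terms of generators.\<close>
  define h where "h = (\<lambda>y\<in>Trace. THE z. Q y z)"
  have Q_h: "Q y (h y)" if "y \<in> Trace" for y
    using Q_ex[OF that] Q_unique that by (simp add: h_def) (metis theI)
  have h_eqI: "h y = z" if "Q y z" "y \<in> Trace" for y z
    using Q_unique Q_h that by blast
  have "h \<in> EndTrace"
    unfolding EndTrace_iff
  proof (intro conjI ballI)
    show "h \<in> Trace \<rightarrow>\<^sub>E Trace"
      using Q_h Q_Trace by (auto simp: PiE_iff) (simp add: h_def)
  \<comment> \<open>Linearity follows from uniqueness, as sums and multiples of solutions solve the
    corresponding equations.\<close>
  qed (simp_all add: h_eqI Q_add Q_smult Q_h)
  moreover have "rho R M h = f"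
    using \<open>h \<in> EndTrace\<close> f by (intro EndDual_ext rho_in_EndDual) (simp_all add: rho_apply h_eqI Q_gen)
  ultimately show ?thesis by blast
qed

lemma bij_betw_rho:
  "bij_betw (rho R M) EndTrace (center (End_algebra R (dual_module R M)))"
proof (rule bij_betw_imageI)
  show "inj_on (rho R M) EndTrace"
    \<comment> \<open>Read backwards, \<open>rho_apply\<close> expresses the values on generators
      through \<open>rho\<close>.\<close>
    by (intro inj_onI EndTrace_ext) (auto dest!: fun_cong simp flip: rho_apply)
  show "rho R M ` EndTrace = center (End_algebra R (dual_module R M))"
    using rho_central rho_surj by blast
qed

section \<open>Compatibility of \<open>rho\<close> with the algebra structures\<close>

lemma rho_algebra_iso:
  "rho R M \<in> algebra_iso R (End_algebra R (ideal_module R Trace))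
    (center_algebra (End_algebra R (dual_module R M)))"
proof -
  have mult: "rho R M (compose Trace g h) = compose Dual (rho R M g) (rho R M h)"
    if "g \<in> EndTrace" "h \<in> EndTrace" for g h
    by (rule extensionalityI[where A = Dual])
      (simp_all add: that rho_def dual_module_simps compose_in_Dual compose_eq,
       simp add: compose_def that cong: restrict_cong)
  have add: "rho R M (\<lambda>y\<in>Trace. g y \<oplus> h y) =
      (\<lambda>\<alpha>\<in>Dual. \<lambda>m\<in>carrier M. rho R M g \<alpha> m \<oplus> rho R M h \<alpha> m)" for g h
    by (rule extensionalityI[where A = Dual])
      (simp_all add: rho_def dual_module_simps compose_def cong: restrict_cong)
  have smult: "rho R M (\<lambda>y\<in>Trace. r \<otimes> h y) =
      (\<lambda>\<alpha>\<in>Dual. \<lambda>m\<in>carrier M. r \<otimes> rho R M h \<alpha> m)" for r h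
    by (rule extensionalityI[where A = Dual])
      (simp_all add: rho_def dual_module_simps compose_def cong: restrict_cong)
  have one: "rho R M (\<lambda>y\<in>Trace. y) = (\<lambda>\<alpha>\<in>Dual. \<alpha>)"
  proof (rule extensionalityI[where A = Dual])
    show "rho R M (\<lambda>y\<in>Trace. y) \<alpha> = (\<lambda>\<alpha>\<in>Dual. \<alpha>) \<alpha>" if \<alpha>: "\<alpha> \<in> Dual" for \<alpha>
      \<comment> \<open>Extensionality of \<alpha> gives equality outside \<open>carrier M\<close>
        too.\<close>
      using \<alpha> mod_homD(1)[OF \<alpha>]
      by (intro extensionalityI[where A = "carrier M"]) (simp_all add: rho_eq compose_eq)
  qed (simp_all add: rho_def dual_module_simps)
  have "rho R M \<in> ring_hom (End_algebra R (ideal_module R Trace))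
    (center_algebra (End_algebra R (dual_module R M)))"
    by (rule ring_hom_memI)
      (simp_all add: center_algebra_def End_algebra_simps dual_module_simps ideal_module_simps
        rho_central mult add one)
  with bij_betw_rho smult show ?thesis
    by (simp add: algebra_iso_def ring_iso_def center_algebra_def End_algebra_simps
        dual_module_simps ideal_module_simps)
qed

end

theorem theorem3p21:
  fixes R :: "('a, 'r) ring_scheme" and M :: "('a, 'b, 'm) module_scheme"
  assumes "cring R" and "noetherian_ring R"
    and "module R M" and "finitely_generated_module R M"
    and "grade R (trace_ideal R M) > 0"
  shows "rho R M \<in> carrier (End_algebra R (ideal_module R (trace_ideal R M)))
            \<rightarrow> center (End_algebra R (dual_module R M))
      \<and> rho R M \<in> algebra_iso R (End_algebra R (ideal_module R (trace_ideal R M)))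
            (center_algebra (End_algebra R (dual_module R M)))"
proof -
  interpret module R M by fact
  obtain x where "x \<in> trace_ideal R M" "\<forall>a\<in>carrier R. x \<otimes>\<^bsub>R\<^esub> a = \<zero>\<^bsub>R\<^esub> \<longrightarrow> a = \<zero>\<^bsub>R\<^esub>"
    using R.nonzerodivisor_if_grade_pos[OF ideal_trace_ideal assms(5)] by blast
  then have reg: "regular_trace R M x"
    by (intro regular_trace.intro regular_trace_axioms.intro module_axioms) simp_all
  show ?thesis
    using regular_trace.rho_algebra_iso[OF reg] regular_trace.rho_central[OF reg]
    by (simp add: End_algebra_simps ideal_module_simps)
qed

end
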